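(* Let $a,r,h>0$ and $$I(a,r,h)=\inf_{(\mu,\rho)}\int_{\mathbb R}rx^2\,\mu(dx)+\int_{\mathbb R\times\{\pm1\}\times[0,\infty)}h|\gamma|\,\rho(dx,d\gamma,d\delta),$$ where the infimum is over Borel probability measures $\mu$ on $\mathbb R$ and finite nonnegative Borel measures $\rho$ on $\mathbb R\times\{\pm1\}\times[0,\infty)$ satisfying $$\int_{\mathbb R}\tfrac12af''(x)\,\mu(dx)+\int_{\mathbb R\times\{\pm1\}\times[0,\infty)}\gamma f'(x)\,\rho(dx,d\gamma,d\delta)=0\qquad\text{for all }f\in C^2_0(\mathbb R).$$ Then $$I(a,r,h)=\big(\tfrac34ar^{1/2}h\big)^{2/3},$$ and the optimum is attained by $$\mu^*(dx)=\frac1{2U}\mathbf 1_{[-U,U]}(x)\,dx,\qquad \rho^*=\frac a{2U}\Big(\tfrac12\delta_{(-U,1,0)}+\tfrac12\delta_{(U,-1,0)}\Big),\qquad U=\big(\tfrac34ar^{-1}h\big)^{1/3}.$$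
   Context: $C^2_0(\mathbb R)$ is the set of twice continuously differentiable real functions on $\mathbb R$ with compact support; $\delta_y$ is the Dirac mass at $y$. *)

theory Defs
  imports "HOL-Probability.Probability"
begin

definition C2_compact_support :: "(real \<Rightarrow> real) set" where
  "C2_compact_support =
    {f. f differentiable_on UNIV \<and> deriv f differentiable_on UNIV \<and>
        continuous_on UNIV (deriv (deriv f)) \<and> compact (closure {x. f x \<noteq> 0})}"

(* The space R x {-1,1} x [0,oo) with coordinates (x, gamma, delta), carrying the trace of the
   Borel sigma-algebra, which is the Borel sigma-algebra of the subspace topology. *)
definition jump_space :: "(real \<times> real \<times> real) measure" where
  "jump_space = restrict_space borel (UNIV \<times> {-1, 1} \<times> {0..})"

(* Both Bochner integrals exist for every test function: the integrands are bounded Borel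
   functions and the measures are finite. *)
definition admissible :: "real \<Rightarrow> (real measure \<times> (real \<times> real \<times> real) measure) set" where
  "admissible a = {(\<mu>, \<rho>).
     sets \<mu> = sets borel \<and> prob_space \<mu> \<and>
     sets \<rho> = sets jump_space \<and> finite_measure \<rho> \<and>
     (\<forall>f \<in> C2_compact_support.
        (\<integral>x. 1 / 2 * a * deriv (deriv f) x \<partial>\<mu>) + (\<integral>(x, \<gamma>, \<delta>). \<gamma> * deriv f x \<partial>\<rho>) = 0)}"

(* Valued in ennreal since the second moment of mu may be infinite. *)
definition cost :: "real \<Rightarrow> real \<Rightarrow> real measure \<times> (real \<times> real \<times> real) measure \<Rightarrow> ennreal" where
  "cost r h = (\<lambda>(\<mu>, \<rho>).
     (\<integral>\<^sup>+x. ennreal (r * x\<^sup>2) \<partial>\<mu>) + (\<integral>\<^sup>+(x, \<gamma>, \<delta>). ennreal (h * \<bar>\<gamma>\<bar>) \<partial>\<rho>))"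

definition optimal_value :: "real \<Rightarrow> real \<Rightarrow> real \<Rightarrow> ennreal" where
  "optimal_value a r h = (INF p \<in> admissible a. cost r h p)"

definition mu_star :: "real \<Rightarrow> real measure" where
  "mu_star U = density lborel (\<lambda>x. ennreal (1 / (2 * U) * indicator {-U..U} x))"

definition rho_star :: "real \<Rightarrow> real \<Rightarrow> (real \<times> real \<times> real) measure" where
  "rho_star a U = measure_of (space jump_space) (sets jump_space)
     (\<lambda>A. ennreal (a / (2 * U)) *
       (ennreal (1 / 2) * emeasure (return jump_space (-U, 1, 0)) A +
        ennreal (1 / 2) * emeasure (return jump_space (U, -1, 0)) A))"

end

theory Submission
  imports Defs
begin

text \<open>
  The lower bound is linear programming duality: a test function \<open>f\<close> with \<open>\<bar>f'\<bar> \<le> h\<close> and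
  \<open>r x\<^sup>2 + a f''(x) / 2 \<ge> c\<close> everywhere certifies that no admissible pair costs less than \<open>c\<close>.
  Complementary slackness forces \<open>a f''(x) / 2 = r (U\<^sup>2 - x\<^sup>2)\<close> on \<open>[-U, U]\<close> for \<open>c = r U\<^sup>2\<close>, and
  \<open>f'(-U) = -h\<close>, \<open>f'(U) = h\<close>, which fixes \<open>U\<close>. Since \<open>r x\<^sup>2 > c\<close> beyond \<open>U\<close>, there is
  room to bring \<open>f'\<close> back to zero on \<open>U \<le> \<bar>x\<bar> \<le> 3 U\<close>, so that a compactly supported \<open>f\<close> attains
  the bound exactly and no truncation limit is needed.
\<close>

section \<open>Truncated powers and their derivatives\<close>

text \<open>The truncated power with knot at 0. With \<open>max\<close> inside the power, continuity
  is immediate for every \<open>n\<close>; for \<open>n = 0\<close> the value is 1 everywhere, not a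
  step function.\<close>

definition tpow :: "nat \<Rightarrow> real \<Rightarrow> real" where
  "tpow n x = (max 0 x) ^ n"

lemma tpow_nonneg: "0 \<le> x \<Longrightarrow> tpow n x = x ^ n"
  by (simp add: tpow_def)

lemma tpow_nonpos: "x \<le> 0 \<Longrightarrow> 0 < n \<Longrightarrow> tpow n x = 0"
  by (simp add: tpow_def)

lemma continuous_on_tpow [continuous_intros]:
  "continuous_on A f \<Longrightarrow> continuous_on A (\<lambda>x. tpow n (f x))"
  unfolding tpow_def by (intro continuous_intros)

text \<open>Away from 0 the function agrees locally with 0 or with \<open>y ^ n\<close>. At 0 the
  difference quotient is at most \<open>\<bar>y\<bar> ^ (n - 1)\<close>, which tends to 0 because
  \<open>n\<close> is at least 2; for \<open>n = 1\<close> there is a kink.\<close>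

lemma has_real_derivative_tpow:
  assumes "2 \<le> n"
  shows "(tpow n has_real_derivative real n * tpow (n - 1) x) (at x)"
proof -
  consider "x < 0" | "x = 0" | "0 < x" by linarith
  then show ?thesis
  proof cases
    case 1
    have "((\<lambda>_. 0) has_real_derivative real n * tpow (n - 1) x) (at x)"
      using 1 assms by (simp add: tpow_nonpos)
    then show ?thesis
      by (rule has_field_derivative_transform_within_open[where S = "{..<0}"])
         (use 1 assms in \<open>auto simp: tpow_nonpos\<close>)
  next
    case 2
    \<comment> \<open>This makes the exponent \<open>n - 1 = Suc m\<close> visibly positive, so the
      comparison function vanishes at 0.\<close>
    obtain m where n: "n = Suc (Suc m)"
      using assms by (metis One_nat_def Suc_1 Suc_le_D Suc_le_mono)
    have "((\<lambda>y. tpow n y / y) \<longlongrightarrow> 0) (at 0)"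
    proof (rule Lim_null_comparison)
      show "\<forall>\<^sub>F y in at 0. norm (tpow n y / y) \<le> \<bar>y\<bar> ^ Suc m"
      proof (rule always_eventually, rule allI)
        fix y :: real
        show "norm (tpow n y / y) \<le> \<bar>y\<bar> ^ Suc m"
          by (cases "0 \<le> y") (simp_all add: n tpow_def del: power_Suc, simp)
      qed
      have "((\<lambda>y::real. \<bar>y\<bar> ^ Suc m) \<longlongrightarrow> \<bar>0\<bar> ^ Suc m) (at 0)"
        by (intro tendsto_intros)
      then show "((\<lambda>y::real. \<bar>y\<bar> ^ Suc m) \<longlongrightarrow> 0) (at 0)" by simp
    qed
    then show ?thesis
      using 2 assms by (simp add: has_field_derivative_iff tpow_nonpos)
  next
    case 3
    have "((\<lambda>y. y ^ n) has_real_derivative real n * tpow (n - 1) x) (at x)"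
      using 3 by (auto intro!: derivative_eq_intros simp: tpow_nonneg)
    then show ?thesis
      by (rule has_field_derivative_transform_within_open[where S = "{0<..}"])
         (use 3 in \<open>auto simp: tpow_nonneg\<close>)
  qed
qed

lemma has_real_derivative_tpow_chain [derivative_intros]:
  assumes "(f has_real_derivative f') (at x)" and "2 \<le> n"
    and "D = real n * tpow (n - 1) (f x) * f'"
  shows "((\<lambda>x. tpow n (f x)) has_real_derivative D) (at x)"
  unfolding assms(3) by (rule DERIV_chain2[OF has_real_derivative_tpow[OF assms(2)] assms(1)])

section \<open>The dual certificate: a compactly supported quartic spline\<close>

text \<open>
  Up to the factor \<open>2 r / a\<close>, the second derivative of the certificate is
  \<open>U\<^sup>2 - x\<^sup>2\<close> for \<open>\<bar>x\<bar> \<le> U\<close>, \<open>(3 U - \<bar>x\<bar>) (U - \<bar>x\<bar>) / 2\<close> for \<open>U \<le> \<bar>x\<bar> \<le> 3 U\<close>, and zero beyond;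
  the truncated powers at the knots \<open>-3 U, -U, U, 3 U\<close> encode the jumps between these pieces,
  and make the antiderivatives explicit.
\<close>

definition spline2 :: "real \<Rightarrow> real \<Rightarrow> real" where
  "spline2 U x =
     tpow 2 (x + 3 * U) / 2 - U * tpow 1 (x + 3 * U)
     - 3 / 2 * tpow 2 (x + U) + U * tpow 1 (x + U)
     + 3 / 2 * tpow 2 (x - U) + U * tpow 1 (x - U)
     - tpow 2 (x - 3 * U) / 2 - U * tpow 1 (x - 3 * U)"

text \<open>Termwise antiderivative of \<open>spline2\<close> without constants: it vanishes left of
  -3U, where all truncated powers do.\<close>

definition spline1 :: "real \<Rightarrow> real \<Rightarrow> real" where
  "spline1 U x =
     tpow 3 (x + 3 * U) / 6 - U * tpow 2 (x + 3 * U) / 2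
     - tpow 3 (x + U) / 2 + U * tpow 2 (x + U) / 2
     + tpow 3 (x - U) / 2 + U * tpow 2 (x - U) / 2
     - tpow 3 (x - 3 * U) / 6 - U * tpow 2 (x - 3 * U) / 2"

definition spline0 :: "real \<Rightarrow> real \<Rightarrow> real" where
  "spline0 U x =
     tpow 4 (x + 3 * U) / 24 - U * tpow 3 (x + 3 * U) / 6
     - tpow 4 (x + U) / 8 + U * tpow 3 (x + U) / 6
     + tpow 4 (x - U) / 8 + U * tpow 3 (x - U) / 6
     - tpow 4 (x - 3 * U) / 24 - U * tpow 3 (x - 3 * U) / 6"

lemma DERIV_spline0: "(spline0 U has_real_derivative spline1 U x) (at x)"
  unfolding spline0_def[abs_def] spline1_def
  by (rule derivative_eq_intros refl | simp)+

lemma DERIV_spline1: "(spline1 U has_real_derivative spline2 U x) (at x)"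
  unfolding spline1_def[abs_def] spline2_def
  by (rule derivative_eq_intros refl | simp)+

lemma continuous_spline2: "continuous_on A (spline2 U)"
  unfolding spline2_def[abs_def] by (intro continuous_intros) auto

text \<open>Left of -3U every truncated power is 0. Right of 3U all are ordinary powers and the
  quartic cancels identically: \<open>spline2\<close> is even, and its integral 2U^3/3 over [0, U]
  is offset by the one over [U, 3U].\<close>

lemma spline0_eq_0:
  assumes "U > 0" and "3 * U \<le> \<bar>x\<bar>"
  shows "spline0 U x = 0"
proof (cases "0 \<le> x")
  case True
  then show ?thesis using assms
    by (simp add: spline0_def tpow_nonneg field_simps) algebra
next
  case False
  then show ?thesis using assms by (simp add: spline0_def tpow_nonpos)
qed

lemma spline_cases:
  fixes U x :: real
  assumes "U > 0"
  obtains "x \<le> - 3 * U" | "- 3 * U \<le> x" "x \<le> - U" | "\<bar>x\<bar> \<le> U"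
    | "U \<le> x" "x \<le> 3 * U" | "3 * U \<le> x"
  by linarith

text \<open>Dual feasibility for the running cost. There is equality on [-U, U]; on the two return
  pieces the excess factors into two terms of known sign; beyond 3U the spline is 0 and the
  right-hand side is negative.\<close>

lemma spline2_bound:
  assumes "U > 0"
  shows "spline2 U x \<ge> U\<^sup>2 - x\<^sup>2"
  using assms
proof (cases rule: spline_cases[where x = x])
  case 1
  then have "(3 * U)\<^sup>2 \<le> (- x)\<^sup>2" using assms by (intro power_mono) auto
  then have "U\<^sup>2 \<le> x\<^sup>2" by (simp add: power_mult_distrib) (smt (verit) zero_le_power2)
  then show ?thesis using 1 assms by (simp add: spline2_def tpow_nonpos)
next
  case 2
  then have "spline2 U x - (U\<^sup>2 - x\<^sup>2) = (- x - U) * (- U - 3 * x) / 2"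
    using assms by (simp add: spline2_def tpow_nonpos tpow_nonneg field_simps) algebra
  moreover have "(- x - U) * (- U - 3 * x) \<ge> 0" using 2 assms by (intro mult_nonneg_nonneg) auto
  ultimately show ?thesis by simp
next
  case 3
  then have "spline2 U x = U\<^sup>2 - x\<^sup>2" using assms
    by (simp add: spline2_def tpow_nonpos tpow_nonneg field_simps) algebra
  then show ?thesis by simp
next
  case 4
  then have "spline2 U x - (U\<^sup>2 - x\<^sup>2) = (x - U) * (3 * x - U) / 2"
    using assms by (simp add: spline2_def tpow_nonpos tpow_nonneg field_simps) algebra
  moreover have "(x - U) * (3 * x - U) \<ge> 0" using 4 assms by (intro mult_nonneg_nonneg) auto
  ultimately show ?thesis by simp
next
  case 5
  then have "spline2 U x = 0"
    using assms by (simp add: spline2_def tpow_nonneg field_simps) algebra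
  moreover have "U\<^sup>2 \<le> x\<^sup>2" using 5 assms by (intro power_mono) auto
  ultimately show ?thesis by simp
qed

text \<open>The extrema sit at U and -U, with values 2U^3/3 and -2U^3/3. The gap to a bound attained
  there has a double root, so it is a square times a linear factor of constant sign on the piece. On
  a return piece the other bound follows from the sign of \<open>spline1\<close>.\<close>

lemma spline1_bound:
  assumes "U > 0"
  shows "\<bar>spline1 U x\<bar> \<le> 2 / 3 * U ^ 3"
  using assms
proof (cases rule: spline_cases[where x = x])
  case 1
  then show ?thesis using assms by (simp add: spline1_def tpow_nonpos)
next
  case 2
  then have eq: "spline1 U x = x * (3 * U + x)\<^sup>2 / 6"
    using assms by (simp add: spline1_def tpow_nonpos tpow_nonneg field_simps) algebra
  have "(U + x)\<^sup>2 * (4 * U + x) \<ge> 0" using 2 assms by (intro mult_nonneg_nonneg) auto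
  moreover have "2 / 3 * U ^ 3 + x * (3 * U + x)\<^sup>2 / 6 = (U + x)\<^sup>2 * (4 * U + x) / 6"
    by (simp add: field_simps) algebra
  moreover have "x * (3 * U + x)\<^sup>2 \<le> 0"
    using 2 assms by (intro mult_nonpos_nonneg) auto
  ultimately show ?thesis unfolding eq by linarith
next
  case 3
  then have eq: "spline1 U x = U\<^sup>2 * x - x ^ 3 / 3"
    using assms by (simp add: spline1_def tpow_nonpos tpow_nonneg field_simps) algebra
  have "(U - x)\<^sup>2 * (2 * U + x) \<ge> 0" "(U + x)\<^sup>2 * (2 * U - x) \<ge> 0"
    using 3 assms by (auto intro!: mult_nonneg_nonneg)
  moreover have "2 / 3 * U ^ 3 - (U\<^sup>2 * x - x ^ 3 / 3) = (U - x)\<^sup>2 * (2 * U + x) / 3"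
    by (simp add: field_simps) algebra
  moreover have "2 / 3 * U ^ 3 + (U\<^sup>2 * x - x ^ 3 / 3) = (U + x)\<^sup>2 * (2 * U - x) / 3"
    by (simp add: field_simps) algebra
  ultimately show ?thesis unfolding eq by linarith
next
  case 4
  then have eq: "spline1 U x = x * (3 * U - x)\<^sup>2 / 6"
    using assms by (simp add: spline1_def tpow_nonpos tpow_nonneg field_simps) algebra
  have "(U - x)\<^sup>2 * (4 * U - x) \<ge> 0" using 4 assms by (intro mult_nonneg_nonneg) auto
  moreover have "2 / 3 * U ^ 3 - x * (3 * U - x)\<^sup>2 / 6 = (U - x)\<^sup>2 * (4 * U - x) / 6"
    by (simp add: field_simps) algebra
  moreover have "x * (3 * U - x)\<^sup>2 \<ge> 0"
    using 4 assms by (intro mult_nonneg_nonneg) auto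
  ultimately show ?thesis unfolding eq by linarith
next
  case 5
  then have "spline1 U x = 0"
    using assms by (simp add: spline1_def tpow_nonneg field_simps) algebra
  then show ?thesis using assms by simp
qed

section \<open>Test functions and their derivatives\<close>

lemma C2_compact_supportI:
  assumes f: "\<And>x. (f has_real_derivative f' x) (at x)"
    and f': "\<And>x. (f' has_real_derivative f'' x) (at x)"
    and "continuous_on UNIV f''" and "\<And>x. R \<le> \<bar>x\<bar> \<Longrightarrow> f x = 0"
  shows "f \<in> C2_compact_support" "deriv f = f'" "deriv (deriv f) = f''"
proof -
  show d: "deriv f = f'" using f by (auto intro: DERIV_imp_deriv)
  show dd: "deriv (deriv f) = f''" unfolding d using f' by (auto intro: DERIV_imp_deriv)
  have "{x. f x \<noteq> 0} \<subseteq> {-R..R}" using assms(4) by (auto simp: abs_le_iff) (smt (verit))+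
  then have "bounded {x. f x \<noteq> 0}"
    using bounded_closed_interval bounded_subset by blast
  moreover have "f differentiable_on UNIV"
    using f by (meson differentiable_at_imp_differentiable_on real_differentiable_def)
  moreover have "f' differentiable_on UNIV"
    using f' by (meson differentiable_at_imp_differentiable_on real_differentiable_def)
  ultimately show "f \<in> C2_compact_support"
    using d dd assms(3) by (simp add: C2_compact_support_def)
qed

lemma C2_compact_supportD:
  assumes "f \<in> C2_compact_support"
  shows "(deriv f has_real_derivative deriv (deriv f) x) (at x)"
    and "continuous_on UNIV (deriv f)" and "continuous_on UNIV (deriv (deriv f))"
proof -
  have "deriv f differentiable_on UNIV" using assms by (simp add: C2_compact_support_def)
  then show "(deriv f has_real_derivative deriv (deriv f) x) (at x)"
    by (simp add: differentiable_on_def DERIV_deriv_iff_real_differentiable)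
  show "continuous_on UNIV (deriv f)"
    using \<open>deriv f differentiable_on UNIV\<close> by (rule differentiable_imp_continuous_on)
  show "continuous_on UNIV (deriv (deriv f))"
    using assms by (simp add: C2_compact_support_def)
qed

section \<open>Measurability on the jump space\<close>

lemma space_jump_space: "space jump_space = UNIV \<times> {-1, 1} \<times> {0..}"
  by (simp add: jump_space_def space_restrict_space)

text \<open>The integrands on the jump space extend continuously to all of R^3, so measurability is
  checked there and then restricted.\<close>

lemma measurable_jump_spaceI:
  "f \<in> borel_measurable borel \<Longrightarrow> f \<in> borel_measurable jump_space"
  unfolding jump_space_def by (rule measurable_restrict_space1)

lemma borel_measurable_jump_drift:
  assumes "continuous_on UNIV (g :: real \<Rightarrow> real)"
  shows "(\<lambda>(x, \<gamma>, \<delta>). \<gamma> * g x) \<in> borel_measurable jump_space"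
proof (intro measurable_jump_spaceI borel_measurable_continuous_onI)
  show "continuous_on UNIV (\<lambda>(x, \<gamma>, \<delta> :: real). \<gamma> * g x)"
    unfolding case_prod_unfold
    by (intro continuous_intros continuous_on_compose2[OF assms]) auto
qed

lemma borel_measurable_jump_cost:
  "(\<lambda>(x, \<gamma>, \<delta>). h * \<bar>\<gamma>\<bar>) \<in> borel_measurable jump_space"
proof (intro measurable_jump_spaceI borel_measurable_continuous_onI)
  show "continuous_on UNIV (\<lambda>(x :: real, \<gamma> :: real, \<delta> :: real). h * \<bar>\<gamma>\<bar>)"
    unfolding case_prod_unfold by (intro continuous_intros)
qed

section \<open>Weak duality and the lower bound\<close>

text \<open>Adding the balance equation for \<open>f\<close> to the cost turns the integrand against
  \<open>\<mu>\<close> into one that is at least \<open>c\<close>, and the one against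
  \<open>\<rho>\<close> into \<open>h * \<bar>\<gamma>\<bar> + \<gamma> * deriv f x\<close>, which
  is nonnegative since \<open>\<bar>\<gamma>\<bar> = 1\<close>. The bound \<open>B\<close> gives
  integrability of the second-order term.\<close>

lemma cost_ge_dual:
  assumes adm: "(\<mu>, \<rho>) \<in> admissible a" and "r > 0" "h > 0"
    and f: "f \<in> C2_compact_support"
    and slope: "\<And>x. \<bar>deriv f x\<bar> \<le> h"
    and dual: "\<And>x. c \<le> r * x\<^sup>2 + 1 / 2 * a * deriv (deriv f) x"
    and bdd: "\<And>x. \<bar>1 / 2 * a * deriv (deriv f) x\<bar> \<le> B"
  shows "ennreal c \<le> cost r h (\<mu>, \<rho>)"
proof -
  from adm have setsm: "sets \<mu> = sets borel" and "prob_space \<mu>"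
    and setsr: "sets \<rho> = sets jump_space" and "finite_measure \<rho>"
    and bal: "(\<integral>x. 1 / 2 * a * deriv (deriv f) x \<partial>\<mu>) + (\<integral>(x, \<gamma>, \<delta>). \<gamma> * deriv f x \<partial>\<rho>) = 0"
    using f by (auto simp: admissible_def)
  interpret \<mu>: prob_space \<mu> by fact
  interpret \<rho>: finite_measure \<rho> by fact
  note [measurable_cong] = setsm setsr
  have spr: "space \<rho> = UNIV \<times> {-1, 1} \<times> {0..}"
    using sets_eq_imp_space_eq[OF setsr] by (simp add: space_jump_space)
  have [measurable]: "deriv (deriv f) \<in> borel_measurable borel"
    using C2_compact_supportD(3)[OF f] by (rule borel_measurable_continuous_onI)
  have mr: "(\<lambda>(x, \<gamma>, \<delta>). h * \<bar>\<gamma>\<bar>) \<in> borel_measurable \<rho>"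
      "(\<lambda>(x, \<gamma>, \<delta>). \<gamma> * deriv f x) \<in> borel_measurable \<rho>"
    using borel_measurable_jump_cost borel_measurable_jump_drift[OF C2_compact_supportD(2)[OF f]]
    by (simp_all add: measurable_cong_sets[OF setsr refl])
  have i1: "integrable \<mu> (\<lambda>x. 1 / 2 * a * deriv (deriv f) x)"
    by (rule \<mu>.integrable_const_bound[where B = B]) (use bdd in auto)
  have i2: "integrable \<rho> (\<lambda>(x, \<gamma>, \<delta>). h * \<bar>\<gamma>\<bar>)"
    by (rule \<rho>.integrable_const_bound[where B = h])
       (use mr \<open>h > 0\<close> in \<open>auto simp: spr intro!: AE_I2\<close>)
  have i3: "integrable \<rho> (\<lambda>(x, \<gamma>, \<delta>). \<gamma> * deriv f x)"
    by (rule \<rho>.integrable_const_bound[where B = h])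
       (use mr slope in \<open>auto simp: spr intro!: AE_I2\<close>)
  show ?thesis
  \<comment> \<open>An infinite second moment makes the cost infinite. A finite one turns the
    running cost into a real integral, which can be combined with the balance equation.\<close>
  proof (cases "(\<integral>\<^sup>+x. ennreal (r * x\<^sup>2) \<partial>\<mu>) = \<infinity>")
    case True
    then show ?thesis by (simp add: cost_def)
  next
    case False
    have i4: "integrable \<mu> (\<lambda>x. r * x\<^sup>2)"
      by (rule integrableI_nonneg) (use False \<open>r > 0\<close> in \<open>auto simp: less_top\<close>)
    have "c = (\<integral>x. c \<partial>\<mu>)" by (simp add: \<mu>.prob_space)
    also have "\<dots> \<le> (\<integral>x. r * x\<^sup>2 + 1 / 2 * a * deriv (deriv f) x \<partial>\<mu>)"
      by (rule integral_mono) (use i1 i4 dual in auto)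
    also have "\<dots> = (\<integral>x. r * x\<^sup>2 \<partial>\<mu>) + (\<integral>x. 1 / 2 * a * deriv (deriv f) x \<partial>\<mu>)"
      using i1 i4 by simp
    finally have c: "c \<le> (\<integral>x. r * x\<^sup>2 \<partial>\<mu>) + (\<integral>x. 1 / 2 * a * deriv (deriv f) x \<partial>\<mu>)" .
    have "- (\<integral>(x, \<gamma>, \<delta>). h * \<bar>\<gamma>\<bar> \<partial>\<rho>) \<le> (\<integral>(x, \<gamma>, \<delta>). \<gamma> * deriv f x \<partial>\<rho>)"
      unfolding integral_minus[symmetric]
    proof (rule integral_mono)
      fix z assume "z \<in> space \<rho>"
      then obtain x \<gamma> \<delta> where z: "z = (x, \<gamma>, \<delta>)" and "\<gamma> = - 1 \<or> \<gamma> = 1"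
        by (auto simp: spr)
      then show "- (case z of (x, \<gamma>, \<delta>) \<Rightarrow> h * \<bar>\<gamma>\<bar>) \<le> (case z of (x, \<gamma>, \<delta>) \<Rightarrow> \<gamma> * deriv f x)"
        using slope[of x] by auto
    qed (use i2 i3 in simp_all)
    with c bal have le: "c \<le> (\<integral>x. r * x\<^sup>2 \<partial>\<mu>) + (\<integral>(x, \<gamma>, \<delta>). h * \<bar>\<gamma>\<bar> \<partial>\<rho>)"
      by linarith
    have "(\<integral>\<^sup>+x. ennreal (r * x\<^sup>2) \<partial>\<mu>) = ennreal (\<integral>x. r * x\<^sup>2 \<partial>\<mu>)"
      by (rule nn_integral_eq_integral[OF i4]) (use \<open>r > 0\<close> in auto)
    moreover have "(\<integral>\<^sup>+(x, \<gamma>, \<delta>). ennreal (h * \<bar>\<gamma>\<bar>) \<partial>\<rho>)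
        = ennreal (\<integral>(x, \<gamma>, \<delta>). h * \<bar>\<gamma>\<bar> \<partial>\<rho>)"
      using nn_integral_eq_integral[OF i2] \<open>h > 0\<close> by (simp add: case_prod_unfold)
    ultimately have "cost r h (\<mu>, \<rho>)
        = ennreal ((\<integral>x. r * x\<^sup>2 \<partial>\<mu>) + (\<integral>(x, \<gamma>, \<delta>). h * \<bar>\<gamma>\<bar> \<partial>\<rho>))"
      using \<open>r > 0\<close> \<open>h > 0\<close>
      by (simp add: cost_def case_prod_unfold ennreal_plus integral_nonneg_AE)
    with le show ?thesis by (simp add: ennreal_leI)
  qed
qed

text \<open>The equation for \<open>U\<close> says that the largest slope of the scaled spline,
  \<open>2 * r / a * (2 / 3 * U ^ 3)\<close>, is exactly \<open>h\<close>.\<close>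

lemma cost_ge:
  assumes adm: "p \<in> admissible a" and "a > 0" "r > 0" "h > 0" "U > 0"
    and U: "4 * r * U ^ 3 = 3 * a * h"
  shows "ennreal (r * U\<^sup>2) \<le> cost r h p"
proof -
  obtain \<mu> \<rho> where p: "p = (\<mu>, \<rho>)" by fastforce
  \<comment> \<open>The factor is chosen so that half of \<open>a\<close> times the second
    derivative of \<open>f\<close> is \<open>r * spline2 U x\<close>.\<close>
  define f where "f = (\<lambda>x. 2 * r / a * spline0 U x)"
  have f: "f \<in> C2_compact_support" "deriv f = (\<lambda>x. 2 * r / a * spline1 U x)"
    "deriv (deriv f) = (\<lambda>x. 2 * r / a * spline2 U x)"
  proof -
    have "(f has_real_derivative 2 * r / a * spline1 U x) (at x)"
      "((\<lambda>x. 2 * r / a * spline1 U x) has_real_derivative 2 * r / a * spline2 U x) (at x)" for x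
      unfolding f_def by (intro DERIV_cmult DERIV_spline0 DERIV_spline1)+
    moreover have "continuous_on UNIV (\<lambda>x. 2 * r / a * spline2 U x)"
      by (intro continuous_on_mult continuous_on_const continuous_spline2)
    moreover have "f x = 0" if "3 * U \<le> \<bar>x\<bar>" for x
      using that \<open>U > 0\<close> by (simp add: f_def spline0_eq_0)
    ultimately show "f \<in> C2_compact_support" "deriv f = (\<lambda>x. 2 * r / a * spline1 U x)"
      "deriv (deriv f) = (\<lambda>x. 2 * r / a * spline2 U x)"
      using C2_compact_supportI[of f "\<lambda>x. 2 * r / a * spline1 U x"
          "\<lambda>x. 2 * r / a * spline2 U x" "3 * U"] by blast+
  qed
  have c: "1 / 2 * a * (2 * r / a * y) = r * y" for y
    using \<open>a > 0\<close> by simp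
  have zero: "spline2 U x = 0" if "x \<notin> {-3 * U..3 * U}" for x
  proof (cases "0 \<le> x")
    case True
    then show ?thesis using that \<open>U > 0\<close>
      by (simp add: spline2_def tpow_nonneg field_simps) algebra
  next
    case False
    then show ?thesis using that \<open>U > 0\<close> by (simp add: spline2_def tpow_nonpos)
  qed
  \<comment> \<open>Compactness bounds the spline between the outer knots; outside them it is 0, and
    \<open>\<bar>B\<bar>\<close> is a bound valid in both regions.\<close>
  have "compact (spline2 U ` {-3 * U..3 * U})"
    by (intro compact_continuous_image continuous_spline2 compact_Icc)
  then obtain B where "\<forall>y \<in> spline2 U ` {-3 * U..3 * U}. norm y \<le> B"
    using compact_imp_bounded bounded_iff by metis
  then have B: "\<bar>spline2 U x\<bar> \<le> B" if "x \<in> {-3 * U..3 * U}" for x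
    using that by auto
  have B': "\<bar>spline2 U x\<bar> \<le> \<bar>B\<bar>" for x
    using B[of x] zero[of x] by (cases "x \<in> {-3 * U..3 * U}") auto
  show ?thesis
    unfolding p
  proof (rule cost_ge_dual[OF _ \<open>r > 0\<close> \<open>h > 0\<close> f(1)])
    show "(\<mu>, \<rho>) \<in> admissible a" using adm p by simp
    fix x
    have "\<bar>deriv f x\<bar> \<le> 2 * r / a * (2 / 3 * U ^ 3)"
      unfolding f(2) using spline1_bound[OF \<open>U > 0\<close>, of x] \<open>r > 0\<close> \<open>a > 0\<close>
      unfolding abs_mult by (intro mult_mono) auto
    also have "\<dots> = h" using U \<open>a > 0\<close> by (simp add: field_simps)
    finally show "\<bar>deriv f x\<bar> \<le> h" .
    have "r * (U\<^sup>2 - x\<^sup>2) \<le> r * spline2 U x"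
      using spline2_bound[OF \<open>U > 0\<close>, of x] \<open>r > 0\<close> by simp
    then show "r * U\<^sup>2 \<le> r * x\<^sup>2 + 1 / 2 * a * deriv (deriv f) x"
      unfolding f(3) c by (simp add: algebra_simps)
    show "\<bar>1 / 2 * a * deriv (deriv f) x\<bar> \<le> r * \<bar>B\<bar>"
      unfolding f(3) c using B' \<open>r > 0\<close> by (simp add: abs_mult)
  qed
qed

section \<open>Integration against the candidate measures\<close>

text \<open>The fundamental theorem of calculus for the uniform law. It serves three times: for the
  total mass, the second moment, and the balance equation with \<open>F = deriv f\<close>.\<close>

lemma integral_mu_star:
  assumes "U > 0" and F: "\<And>x. (F has_real_derivative g x) (at x)"
    and g: "continuous_on UNIV g"
  shows "integrable (mu_star U) g" "(\<integral>x. g x \<partial>mu_star U) = (F U - F (-U)) / (2 * U)"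
proof -
  have [measurable]: "g \<in> borel_measurable borel"
    using g by (rule borel_measurable_continuous_onI)
  have "has_bochner_integral lborel (\<lambda>x. g x * indicator {-U..U} x) (F U - F (-U))"
    by (rule has_bochner_integral_FTC_Icc_real)
       (use assms in \<open>auto intro: has_field_derivative_at_within continuous_on_subset
          simp: continuous_on_eq_continuous_at\<close>)
  from has_bochner_integral_mult_right[OF this, of "1 / (2 * U)"]
  have *: "has_bochner_integral lborel (\<lambda>x. 1 / (2 * U) * (g x * indicator {-U..U} x))
      (1 / (2 * U) * (F U - F (-U)))"
    by simp
  have "has_bochner_integral (mu_star U) g (1 / (2 * U) * (F U - F (-U)))"
    unfolding mu_star_def
    by (rule has_bochner_integral_density) (use * \<open>U > 0\<close> in \<open>auto simp: mult_ac\<close>)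
  then show "integrable (mu_star U) g" "(\<integral>x. g x \<partial>mu_star U) = (F U - F (-U)) / (2 * U)"
    by (auto simp: has_bochner_integral_iff)
qed

lemma sets_mu_star: "sets (mu_star U) = sets borel"
  by (simp add: mu_star_def)

lemma prob_space_mu_star:
  assumes "U > 0"
  shows "prob_space (mu_star U)"
proof
  have "emeasure (mu_star U) (space (mu_star U)) = (\<integral>\<^sup>+x. 1 \<partial>mu_star U)"
    by simp
  also have "\<dots> = (\<integral>\<^sup>+x. ennreal 1 \<partial>mu_star U)" by simp
  also have "\<dots> = ennreal (\<integral>x. 1 \<partial>mu_star U)"
    by (rule nn_integral_eq_integral)
       (auto intro!: integral_mu_star(1)[OF assms, of "\<lambda>x. x"])
  also have "(\<integral>x. 1 \<partial>mu_star U) = (1 :: real)"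
    by (subst integral_mu_star(2)[OF assms, of "\<lambda>x. x"]) (use assms in auto)
  finally show "emeasure (mu_star U) (space (mu_star U)) = 1" by simp
qed

lemma sum_UNIV_bool: "(\<Sum>b\<in>UNIV. f b) = f True + (f False :: 'a :: comm_monoid_add)"
  by (simp add: UNIV_bool add.commute)

text \<open>\<open>measure_of\<close> yields the prescribed values only once the set function is
  known to be a measure. Here it coincides with the push-forward of a two-point measure with weights
  \<open>a / (4 * U)\<close>, which settles this and reduces integrals to sums over
  \<open>bool\<close>.\<close>

lemma rho_star_eq_distr:
  assumes "a > 0" "U > 0"
  shows "rho_star a U = distr (point_measure (UNIV :: bool set) (\<lambda>_. ennreal (a / (4 * U))))
     jump_space (\<lambda>b. if b then (-U, 1, 0) else (U, -1, 0))" (is "_ = distr ?P _ ?T")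
proof -
  have T: "?T \<in> measurable ?P jump_space"
    by (auto simp: measurable_point_measure_eq1 space_jump_space)
  have "rho_star a U = measure_of (space jump_space) (sets jump_space)
      (emeasure (distr ?P jump_space ?T))"
    unfolding rho_star_def
  proof (rule measure_of_eq)
    show "sets jump_space \<subseteq> Pow (space jump_space)" by (rule sets.space_closed)
    fix A assume "A \<in> sigma_sets (space jump_space) (sets jump_space)"
    then have A: "A \<in> sets jump_space" by (simp add: sets.sigma_sets_eq)
    have "emeasure (distr ?P jump_space ?T) A = emeasure ?P {b. ?T b \<in> A}"
      by (subst emeasure_distr[OF T A]) (auto simp: vimage_def space_point_measure)
    also have "\<dots> = (\<Sum>b | ?T b \<in> A. ennreal (a / (4 * U)))"
      by (rule emeasure_point_measure_finite) simp_all
    also have "\<dots> = (\<Sum>b\<in>UNIV. ennreal (a / (4 * U)) * indicator A (?T b))"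
      by (rule sum.mono_neutral_cong_left) (auto simp: indicator_def)
    also have "\<dots> = ennreal (a / (4 * U)) * indicator A (-U, 1, 0)
        + ennreal (a / (4 * U)) * indicator A (U, -1, 0)"
      by (subst sum_UNIV_bool) simp
    finally have emeasure_distr_A: "emeasure (distr ?P jump_space ?T) A
        = ennreal (a / (4 * U)) * indicator A (-U, 1, 0)
          + ennreal (a / (4 * U)) * indicator A (U, -1, 0)" .
    have "ennreal (a / (4 * U)) = ennreal (a / (2 * U)) * ennreal (1 / 2)"
      using assms by (subst ennreal_mult[symmetric]) auto
    then show "ennreal (a / (2 * U)) *
       (ennreal (1 / 2) * emeasure (return jump_space (-U, 1, 0)) A +
        ennreal (1 / 2) * emeasure (return jump_space (U, -1, 0)) A)
      = emeasure (distr ?P jump_space ?T) A"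
      unfolding emeasure_distr_A using A by (simp add: distrib_left mult.assoc)
  qed
  also have "\<dots> = distr ?P jump_space ?T"
    using measure_of_of_measure[of "distr ?P jump_space ?T"] by simp
  finally show ?thesis .
qed

lemma
  assumes "a > 0" "U > 0" and g: "g \<in> borel_measurable jump_space"
  shows integral_rho_star:
      "(\<integral>z. g z \<partial>rho_star a U) = a / (4 * U) * (g (-U, 1, 0) + g (U, -1, 0) :: real)"
    and nn_integral_rho_star:
      "(\<integral>\<^sup>+z. ennreal (g z) \<partial>rho_star a U)
        = ennreal (a / (4 * U)) * (ennreal (g (-U, 1, 0)) + ennreal (g (U, -1, 0)))"
proof -
  let ?P = "point_measure (UNIV :: bool set) (\<lambda>_. ennreal (a / (4 * U)))"
  let ?T = "\<lambda>b. if b then (-U, 1, 0) else (U, -1, 0 :: real)"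
  have T: "?T \<in> measurable ?P jump_space"
    by (auto simp: measurable_point_measure_eq1 space_jump_space)
  show "(\<integral>z. g z \<partial>rho_star a U) = a / (4 * U) * (g (-U, 1, 0) + g (U, -1, 0))"
    unfolding rho_star_eq_distr[OF assms(1,2)]
    by (subst integral_distr[OF T g], subst lebesgue_integral_point_measure_finite)
       (use assms in \<open>auto simp: UNIV_bool algebra_simps\<close>)
  show "(\<integral>\<^sup>+z. ennreal (g z) \<partial>rho_star a U)
      = ennreal (a / (4 * U)) * (ennreal (g (-U, 1, 0)) + ennreal (g (U, -1, 0)))"
    unfolding rho_star_eq_distr[OF assms(1,2)]
    by (subst nn_integral_distr[OF T], use g in measurable, subst nn_integral_point_measure_finite)
       (use assms in \<open>auto simp: UNIV_bool algebra_simps\<close>)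
qed

lemma finite_measure_rho_star:
  assumes "a > 0" "U > 0"
  shows "finite_measure (rho_star a U)"
proof
  have "emeasure (rho_star a U) (space (rho_star a U)) = (\<integral>\<^sup>+z. ennreal 1 \<partial>rho_star a U)"
    by simp
  also have "\<dots> < \<infinity>"
    by (subst nn_integral_rho_star[OF assms]) (auto simp: ennreal_mult_less_top)
  finally show "emeasure (rho_star a U) (space (rho_star a U)) \<noteq> \<infinity>" by simp
qed

section \<open>Admissibility and cost of the candidate pair\<close>

text \<open>The diffusion term averages to \<open>a / (4 * U) * (deriv f U - deriv f (- U))\<close>;
  the two inward pushes at the endpoints contribute the negative of this.\<close>

lemma star_admissible:
  assumes "a > 0" "U > 0"
  shows "(mu_star U, rho_star a U) \<in> admissible a"
proof -
  have "(\<integral>x. 1 / 2 * a * deriv (deriv f) x \<partial>mu_star U)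
      + (\<integral>(x, \<gamma>, \<delta>). \<gamma> * deriv f x \<partial>rho_star a U) = 0"
    if f: "f \<in> C2_compact_support" for f
  proof -
    have "(\<integral>x. 1 / 2 * a * deriv (deriv f) x \<partial>mu_star U)
        = 1 / 2 * a * ((deriv f U - deriv f (- U)) / (2 * U))"
      using integral_mu_star(2)[OF \<open>U > 0\<close> C2_compact_supportD(1,3)[OF f]] by simp
    moreover have "(\<integral>(x, \<gamma>, \<delta>). \<gamma> * deriv f x \<partial>rho_star a U)
        = a / (4 * U) * (deriv f (- U) - deriv f U)"
      unfolding integral_rho_star[OF assms borel_measurable_jump_drift[OF C2_compact_supportD(2)[OF f]]]
      by simp
    moreover have "1 / 2 * a * ((deriv f U - deriv f (- U)) / (2 * U))
        + a / (4 * U) * (deriv f (- U) - deriv f U) = 0"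
      using \<open>U > 0\<close> by (simp add: field_simps)
    ultimately show ?thesis by argo
  qed
  moreover have "sets (rho_star a U) = sets jump_space"
    by (simp add: rho_star_eq_distr[OF assms])
  ultimately show ?thesis
    using assms by (simp add: admissible_def sets_mu_star prob_space_mu_star finite_measure_rho_star)
qed

text \<open>The second moment contributes r U^2 / 3 and the jumps a h / (2U), which the equation for
  \<open>U\<close> turns into 2 r U^2 / 3.\<close>

lemma cost_star:
  assumes "a > 0" "r > 0" "h > 0" "U > 0" and U: "4 * r * U ^ 3 = 3 * a * h"
  shows "cost r h (mu_star U, rho_star a U) = ennreal (r * U\<^sup>2)"
proof -
  have D: "((\<lambda>x. r * x ^ 3 / 3) has_real_derivative r * x\<^sup>2) (at x)" for x
    by (auto intro!: derivative_eq_intros)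
  have cont: "continuous_on UNIV (\<lambda>x::real. r * x\<^sup>2)"
    by (intro continuous_intros)
  have "(\<integral>\<^sup>+x. ennreal (r * x\<^sup>2) \<partial>mu_star U) = ennreal (\<integral>x. r * x\<^sup>2 \<partial>mu_star U)"
    by (rule nn_integral_eq_integral[OF integral_mu_star(1)[OF \<open>U > 0\<close> D cont]])
       (use \<open>r > 0\<close> in auto)
  also have "(\<integral>x. r * x\<^sup>2 \<partial>mu_star U) = r * U\<^sup>2 / 3"
    unfolding integral_mu_star(2)[OF \<open>U > 0\<close> D cont]
    using \<open>U > 0\<close> by (simp add: field_simps power2_eq_square power3_eq_cube)
  finally have 1: "(\<integral>\<^sup>+x. ennreal (r * x\<^sup>2) \<partial>mu_star U) = ennreal (r * U\<^sup>2 / 3)" .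
  have "(\<integral>\<^sup>+(x, \<gamma>, \<delta>). ennreal (h * \<bar>\<gamma>\<bar>) \<partial>rho_star a U)
      = ennreal (a / (4 * U)) * (ennreal h + ennreal h)"
    using nn_integral_rho_star[OF \<open>a > 0\<close> \<open>U > 0\<close> borel_measurable_jump_cost[of h]]
    by (simp add: case_prod_unfold)
  also have "\<dots> = ennreal (a / (4 * U) * (h + h))"
    using assms by (simp only: ennreal_mult ennreal_plus divide_nonneg_nonneg less_imp_le
        add_nonneg_nonneg mult_nonneg_nonneg zero_le_numeral)
  also have "a / (4 * U) * (h + h) = 2 * r * U\<^sup>2 / 3"
    using U \<open>U > 0\<close> by (simp add: field_simps power2_eq_square power3_eq_cube)
  finally have "(\<integral>\<^sup>+(x, \<gamma>, \<delta>). ennreal (h * \<bar>\<gamma>\<bar>) \<partial>rho_star a U) = ennreal (2 * r * U\<^sup>2 / 3)" .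
  with 1 show ?thesis
    using \<open>r > 0\<close> by (simp add: cost_def ennreal_plus[symmetric] del: ennreal_plus)
qed

section \<open>Evaluation of the optimal value in closed form\<close>

theorem proposition4p2:
  fixes a r h :: real
  assumes "a > 0" and "r > 0" and "h > 0"
  shows "optimal_value a r h = ennreal ((3 / 4 * a * r powr (1 / 2) * h) powr (2 / 3)) \<and>
    (let U = (3 / 4 * a * inverse r * h) powr (1 / 3)
     in (mu_star U, rho_star a U) \<in> admissible a \<and>
        cost r h (mu_star U, rho_star a U) = optimal_value a r h)"
proof -
  \<comment> \<open>\<open>w\<close> is the cube of the optimal half-width, so
    \<open>U ^ 3 = w\<close> gives the equation required by both the lower bound and the cost of the
    candidate.\<close>
  define w where "w = 3 / 4 * a * inverse r * h"
  define U where "U = w powr (1 / 3)"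
  have "w > 0" using assms by (simp add: w_def)
  then have "U > 0" by (simp add: U_def)
  have "U ^ 3 = w" "U\<^sup>2 = w powr (2 / 3)"
    using \<open>w > 0\<close> by (simp_all add: U_def powr_power)
  then have U3: "4 * r * U ^ 3 = 3 * a * h"
    using assms by (simp add: w_def field_simps)
  \<comment> \<open>Splitting off r^(3/2) leaves \<open>w\<close>; raising to the power 2/3 then
    gives r times w^(2/3), which is r U^2.\<close>
  have "3 / 4 * a * r powr (1 / 2) * h = r powr (3 / 2) * w"
    using assms powr_add[of r "1 / 2" 1] by (simp add: w_def)
  then have val: "(3 / 4 * a * r powr (1 / 2) * h) powr (2 / 3) = r * U\<^sup>2"
    using assms \<open>w > 0\<close> \<open>U\<^sup>2 = _\<close> by (simp add: powr_mult powr_powr)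
  note adm = star_admissible[OF \<open>a > 0\<close> \<open>U > 0\<close>]
  note cst = cost_star[OF assms \<open>U > 0\<close> U3]
  have "optimal_value a r h = ennreal (r * U\<^sup>2)"
    unfolding optimal_value_def
  proof (rule antisym)
    show "(INF p\<in>admissible a. cost r h p) \<le> ennreal (r * U\<^sup>2)"
      using INF_lower[OF adm, of "cost r h"] cst by simp
    show "ennreal (r * U\<^sup>2) \<le> (INF p\<in>admissible a. cost r h p)"
      by (intro INF_greatest cost_ge[OF _ assms \<open>U > 0\<close> U3])
  qed
  then show ?thesis
    using adm cst val by (simp add: Let_def U_def w_def)
qed

end
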